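(* If $n\ge 3$ is an integer, then $\mathrm{rc}(S(n,3))=3\cdot 2^{n-2}-1$.
   Context: For integers $n\ge 0$, $k\ge 1$, the Sierpiński graph $S(n,k)$ has vertex set $[k]^n$ (words of length $n$ over $[k]=\{1,\dots,k\}$) and edges defined recursively: $E(S(0,k))=\emptyset$ and $E(S(n,k))=\{\{ix,iy\} \mid i\in[k], \{x,y\}\in E(S(n-1,k))\}\cup\{\{ij^{n-1},ji^{n-1}\} \mid i,j\in[k], i\ne j\}$. Cop and robber game with radius of capture $r$: first the cop chooses a vertex, then the robber; afterwards, starting with the cop, the players alternately either move to an adjacent vertex or stay put, both knowing both positions. The cop wins if at some point the distance between the players is at most $r$. $\mathcal{CWRC}(r)$ is the class of graphs on which the cop has a winning strategy. $\mathrm{rc}(G)=\min\{r\in\mathbb{N}_0 \mid G\in\mathcal{CWRC}(r)\}$. *)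

theory Defs
  imports "Graph_Theory.Pair_Digraph" "Graph_Theory.Shortest_Path"
begin

text \<open>
  Finite simple graphs are represented as in \<open>Graph_Theory\<close>: symmetric loop-free digraphs
  without parallel arcs (locale \<^locale>\<open>graph\<close>), an edge \<open>{u, v}\<close> being the two arcs
  \<open>(u, v)\<close> and \<open>(v, u)\<close>.
\<close>

subsection \<open>Sierpinski graphs\<close>

definition words :: "nat \<Rightarrow> nat \<Rightarrow> nat list set" where
  "words n k = {w. length w = n \<and> set w \<subseteq> {1..k}}"

primrec sierpinski_arcs :: "nat \<Rightarrow> nat \<Rightarrow> nat list rel" where
  "sierpinski_arcs 0 k = {}"
| "sierpinski_arcs (Suc n) k =
     {(i # x, i # y) | i x y. i \<in> {1..k} \<and> (x, y) \<in> sierpinski_arcs n k} \<union>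
     {(i # replicate n j, j # replicate n i) | i j. i \<in> {1..k} \<and> j \<in> {1..k} \<and> i \<noteq> j}"

definition sierpinski :: "nat \<Rightarrow> nat \<Rightarrow> nat list pair_pre_digraph" where
  "sierpinski n k = \<lparr> pverts = words n k, parcs = sierpinski_arcs n k \<rparr>"

lemma sierpinski_arcs_words:
  "(x, y) \<in> sierpinski_arcs n k \<Longrightarrow> x \<in> words n k \<and> y \<in> words n k \<and> x \<noteq> y"
proof (induction n arbitrary: x y)
  case (Suc n)
  from Suc.prems consider
      (old) i x' y' where "x = i # x'" "y = i # y'" "i \<in> {1..k}" "(x', y') \<in> sierpinski_arcs n k"
    | (new) i j where "x = i # replicate n j" "y = j # replicate n i"
        "i \<in> {1..k}" "j \<in> {1..k}" "i \<noteq> j"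
    by auto
  then show ?case
  proof cases
    case old
    then show ?thesis
      using Suc.IH[OF old(4)] by (simp add: words_def)
  next
    case new
    then show ?thesis
      by (auto simp: words_def)
  qed
qed simp

lemma sierpinski_arcs_sym:
  "(x, y) \<in> sierpinski_arcs n k \<Longrightarrow> (y, x) \<in> sierpinski_arcs n k"
proof (induction n arbitrary: x y)
  case (Suc n)
  from Suc.prems show ?case
    by (auto intro: Suc.IH)
qed simp

lemma finite_words: "finite (words n k)"
  using finite_lists_length_eq[of "{1..k}" n] by (simp add: words_def conj_commute)

lemma pair_graph_sierpinski: "pair_graph (sierpinski n k)"
proof -
  have "sierpinski_arcs n k \<subseteq> words n k \<times> words n k"
    using sierpinski_arcs_words by auto
  then have "finite (sierpinski_arcs n k)"
    by (rule finite_subset) (simp add: finite_words)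
  then show ?thesis
    using sierpinski_arcs_words
    by unfold_locales
      (force simp: sierpinski_def finite_words symmetric_def sym_def intro: sierpinski_arcs_sym)+
qed

lemma graph_sierpinski: "graph (with_proj (sierpinski n k))"
  by (rule pair_graph.pair_graphD_graph[OF pair_graph_sierpinski])


subsection \<open>The game of cop and robber with radius of capture\<close>

text \<open>
  The graph distance is the weighted distance of \<open>Graph_Theory\<close> with all arc weights 1
  (infinite between different components).
\<close>
definition graph_dist :: "('a, 'b) pre_digraph \<Rightarrow> 'a \<Rightarrow> 'a \<Rightarrow> ereal" where
  "graph_dist G u v = wf_digraph.\<mu> G (\<lambda>_. 1) u v"

definition legal_move :: "('a, 'b) pre_digraph \<Rightarrow> 'a \<Rightarrow> 'a \<Rightarrow> bool" where
  "legal_move G u v \<longleftrightarrow> u = v \<or> u \<rightarrow>\<^bsub>G\<^esub> v"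

text \<open>
  A strategy of the cop assigns the cop's next position to the history of the game, i.e. to the
  list of all (cop position, robber position) pairs of the completed rounds. Round 0 is the choice
  of the initial vertices, so \<open>\<sigma> []\<close> is the cop's initial vertex. In round \<open>t > 0\<close> the
  cop moves first. \<open>\<rho> t\<close> is the robber's position after round \<open>t\<close>.
\<close>
type_synonym 'a cop_strategy = "('a \<times> 'a) list \<Rightarrow> 'a"

primrec history :: "'a cop_strategy \<Rightarrow> (nat \<Rightarrow> 'a) \<Rightarrow> nat \<Rightarrow> ('a \<times> 'a) list" where
  "history \<sigma> \<rho> 0 = []"
| "history \<sigma> \<rho> (Suc t) = history \<sigma> \<rho> t @ [(\<sigma> (history \<sigma> \<rho> t), \<rho> t)]"

definition cop_pos :: "'a cop_strategy \<Rightarrow> (nat \<Rightarrow> 'a) \<Rightarrow> nat \<Rightarrow> 'a" where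
  "cop_pos \<sigma> \<rho> t = \<sigma> (history \<sigma> \<rho> t)"

definition legal_play :: "('a, 'b) pre_digraph \<Rightarrow> (nat \<Rightarrow> 'a) \<Rightarrow> bool" where
  "legal_play G p \<longleftrightarrow> p 0 \<in> verts G \<and> (\<forall>t. legal_move G (p t) (p (Suc t)))"

text \<open>
  The capture condition is tested after each placement and after each move of either player.
  Play formally goes on after a capture; this is harmless, as a player may always stay put.
\<close>
definition captures ::
    "('a, 'b) pre_digraph \<Rightarrow> nat \<Rightarrow> (nat \<Rightarrow> 'a) \<Rightarrow> (nat \<Rightarrow> 'a) \<Rightarrow> bool" where
  "captures G r c \<rho> \<longleftrightarrow>
     (\<exists>t. graph_dist G (c t) (\<rho> t) \<le> ereal (real r) \<or>
          graph_dist G (c (Suc t)) (\<rho> t) \<le> ereal (real r))"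

text \<open>
  Quantifying over all legal robber sequences \<open>\<rho>\<close> covers every robber that sees the cop's
  positions: the cop's strategy is fixed, and \<open>cop_pos \<sigma> \<rho> t\<close> depends only on
  \<open>\<rho> 0, \<dots>, \<rho> (t - 1)\<close>.
\<close>
definition winning_strategy :: "('a, 'b) pre_digraph \<Rightarrow> nat \<Rightarrow> 'a cop_strategy \<Rightarrow> bool" where
  "winning_strategy G r \<sigma> \<longleftrightarrow>
     (\<forall>\<rho>. legal_play G \<rho> \<longrightarrow> legal_play G (cop_pos \<sigma> \<rho>) \<and> captures G r (cop_pos \<sigma> \<rho>) \<rho>)"

definition CWRC :: "nat \<Rightarrow> ('a, 'b) pre_digraph set" where
  "CWRC r = {G. graph G \<and> verts G \<noteq> {} \<and> (\<exists>\<sigma>. winning_strategy G r \<sigma>)}"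

definition rc :: "('a, 'b) pre_digraph \<Rightarrow> nat" where
  "rc G = (LEAST r. G \<in> CWRC r)"

end

theory Submission
  imports Defs
begin

text \<open>
  Lower bound: \<open>S(n, 3)\<close> retracts without increasing distances onto its central cycle, of length
  \<open>6 * 2 ^ (n - 2)\<close>. The robber stays on this cycle, always opposite to the image of the cop, so after
  each move of the cop the distance is still at least \<open>3 * 2 ^ (n - 2) - 1\<close>.

  Upper bound: with radius of capture \<open>3 * 2 ^ (n - 2) - 1\<close> it suffices that the cop walks along the
  central cycle from \<open>1 2\<^sup>n\<^sup>-\<^sup>1\<close> to \<open>1 3\<^sup>n\<^sup>-\<^sup>1\<close>, regardless of the robber. The robber has to start in the
  third copy of \<open>S(n - 1, 3)\<close> and cannot leave it without being captured, but at the end of the walk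
  that whole copy is within the radius of capture.
\<close>

section \<open>Walks and distances\<close>

lemma (in pair_wf_digraph) awalk_imp_relpow:
  "awalk u p v \<Longrightarrow> (u, v) \<in> parcs G ^^ length p"
proof (induction p arbitrary: u)
  case (Cons e p)
  then have "e \<in> parcs G" "fst e = u" "(snd e, v) \<in> parcs G ^^ length p"
    by (auto simp: awalk_Cons_iff)
  then show ?case
    by (metis length_Cons prod.collapse relpow_Suc_I2)
qed (auto simp: awalk_Nil_iff)

lemma (in pair_wf_digraph) relpow_imp_awalk:
  "(u, v) \<in> parcs G ^^ d \<Longrightarrow> u \<in> pverts G \<Longrightarrow> \<exists>p. awalk u p v \<and> length p = d"
proof (induction d arbitrary: u)
  case 0
  then show ?case
    by (auto simp: awalk_Nil_iff)
next
  case (Suc d)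
  then obtain w where "(u, w) \<in> parcs G" "(w, v) \<in> parcs G ^^ d"
    by (meson relpow_Suc_D2)
  moreover from this obtain p where "awalk w p v" "length p = d"
    using Suc.IH in_arcsD2 by blast
  ultimately have "awalk u ((u, w) # p) v \<and> length ((u, w) # p) = Suc d"
    using Suc.prems(2) by (simp add: awalk_Cons_iff)
  then show ?case ..
qed

text \<open>With weight 1 the cost of a walk is its length, an integer, so a bound \<open>r\<close>
  on the infimum is met by some walk. This turns capture into a question about relational powers of
  the arc set.\<close>

lemma (in pair_wf_digraph) graph_dist_le_iff:
  assumes "u \<in> pverts G"
  shows "graph_dist (with_proj G) u v \<le> ereal (real r) \<longleftrightarrow> (\<exists>d\<le>r. (u, v) \<in> parcs G ^^ d)"
proof
  have cost: "awalk_cost (\<lambda>_. 1) p = real (length p)" for p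
    by (induction p) auto
  {
    assume le: "graph_dist (with_proj G) u v \<le> ereal (real r)"
    show "\<exists>d\<le>r. (u, v) \<in> parcs G ^^ d"
    proof (rule ccontr)
      assume far: "\<not> (\<exists>d\<le>r. (u, v) \<in> parcs G ^^ d)"
      have "ereal (real (Suc r)) \<le> graph_dist (with_proj G) u v"
        unfolding graph_dist_def \<mu>_def
      proof (rule INF_greatest)
        fix p assume "p \<in> {p. awalk u p v}"
        then have "Suc r \<le> length p"
          using far awalk_imp_relpow[of u p v] not_less_eq_eq by blast
        then show "ereal (real (Suc r)) \<le> ereal (awalk_cost (\<lambda>_. 1) p)"
          unfolding cost by simp
      qed
      with le have "ereal (real (Suc r)) \<le> ereal (real r)"
        by (rule order_trans[rotated])
      then show False
        by simp
    qed
  next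
    assume "\<exists>d\<le>r. (u, v) \<in> parcs G ^^ d"
    then obtain p where "awalk u p v" "length p \<le> r"
      using relpow_imp_awalk[OF _ assms] by blast
    then show "graph_dist (with_proj G) u v \<le> ereal (real r)"
      using min_cost_le_walk_cost[of u p v "\<lambda>_. 1"] unfolding graph_dist_def cost
      by (meson ereal_less_eq(3) of_nat_le_iff order_trans)
  }
qed

lemma sierpinski_simps [simp]:
  "pverts (sierpinski n k) = words n k" "parcs (sierpinski n k) = sierpinski_arcs n k"
  by (simp_all add: sierpinski_def)

lemma graph_dist_sierpinski_le_iff:
  assumes "u \<in> words n k"
  shows "graph_dist (with_proj (sierpinski n k)) u v \<le> ereal (real r) \<longleftrightarrow>
    (\<exists>d\<le>r. (u, v) \<in> sierpinski_arcs n k ^^ d)"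
proof -
  interpret pair_graph "sierpinski n k"
    by (rule pair_graph_sierpinski)
  show ?thesis
    using graph_dist_le_iff[of u v r] assms by simp
qed

lemma sym_relpow: "sym R \<Longrightarrow> sym (R ^^ d)"
proof (induction d)
  case (Suc d)
  show ?case
  proof (rule symI)
    fix x y assume "(x, y) \<in> R ^^ Suc d"
    then obtain z where "(x, z) \<in> R ^^ d" "(z, y) \<in> R"
      by (rule relpow_Suc_E)
    with Suc show "(y, x) \<in> R ^^ Suc d"
      by (meson relpow_Suc_I2 symD)
  qed
qed (simp add: sym_Id)

lemma relpow_sierpinski_sym:
  "(x, y) \<in> sierpinski_arcs n k ^^ d \<Longrightarrow> (y, x) \<in> sierpinski_arcs n k ^^ d"
  by (rule symD[OF sym_relpow]) (auto simp: sym_def intro: sierpinski_arcs_sym)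

lemma relpow_sierpinski_Cons:
  assumes "(x, y) \<in> sierpinski_arcs n k ^^ d" "i \<in> {1..k}"
  shows "(i # x, i # y) \<in> sierpinski_arcs (Suc n) k ^^ d"
  using assms(1)
proof (induction d arbitrary: y)
  case (Suc d)
  then obtain z where z: "(x, z) \<in> sierpinski_arcs n k ^^ d" "(z, y) \<in> sierpinski_arcs n k"
    by (meson relpow_Suc_E)
  then have "(i # z, i # y) \<in> sierpinski_arcs (Suc n) k"
    using assms(2) by auto
  with Suc.IH[OF z(1)] show ?case
    by (rule relpow_Suc_I)
qed simp

lemma bridge_arc:
  "i \<in> {1..k} \<Longrightarrow> j \<in> {1..k} \<Longrightarrow> i \<noteq> j \<Longrightarrow>
    (i # replicate n j, j # replicate n i) \<in> sierpinski_arcs (Suc n) k"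
  by auto

lemma relpow_trans: "(x, y) \<in> R ^^ a \<Longrightarrow> (y, z) \<in> R ^^ b \<Longrightarrow> (x, z) \<in> R ^^ (a + b)"
  by (auto simp: relpow_add)

lemma relpow_bridge:
  assumes "i \<in> {1..k}" "j \<in> {1..k}" "i \<noteq> j"
    and "(x, replicate n j) \<in> sierpinski_arcs n k ^^ a"
    and "(replicate n i, y) \<in> sierpinski_arcs n k ^^ b"
  shows "(i # x, j # y) \<in> sierpinski_arcs (Suc n) k ^^ (a + 1 + b)"
proof -
  have "(i # replicate n j, j # replicate n i) \<in> sierpinski_arcs (Suc n) k ^^ 1"
    using assms(1-3) bridge_arc by auto
  then show ?thesis
    using assms relpow_sierpinski_Cons relpow_trans by metis
qed


section \<open>Distance to the extreme vertices\<close>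

text \<open>The classical formula for the distance to the extreme vertex
  \<open>replicate n j\<close>: the word read as a binary number with digit 0 at each letter
  \<open>j\<close> and digit 1 elsewhere.\<close>

primrec corner_dist :: "nat \<Rightarrow> nat list \<Rightarrow> nat" where
  "corner_dist j [] = 0"
| "corner_dist j (i # x) = (if i = j then 0 else 2 ^ length x) + corner_dist j x"

lemma corner_dist_replicate:
  "corner_dist j (replicate n i) = (if i = j then 0 else 2 ^ n - 1)"
  by (induction n) auto

lemma corner_dist_less: "corner_dist j x < 2 ^ length x"
  by (induction x) auto

lemma words_Suc: "words (Suc n) k = {i # x | i x. i \<in> {1..k} \<and> x \<in> words n k}"
  by (auto simp: words_def length_Suc_conv)

lemma replicate_words: "j \<in> {1..k} \<Longrightarrow> replicate n j \<in> words n k"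
  by (auto simp: words_def)

text \<open>To reach another copy \<open>i\<close>, cross copy \<open>j\<close> in
  \<open>2 ^ n - 1\<close> steps and take the bridge. It ends at \<open>i # replicate n j\<close>,
  where the induction hypothesis continues.\<close>

lemma corner_walk:
  "x \<in> words n k \<Longrightarrow> j \<in> {1..k} \<Longrightarrow>
    (replicate n j, x) \<in> sierpinski_arcs n k ^^ corner_dist j x"
proof (induction n arbitrary: x j)
  case 0
  then show ?case
    by (simp add: words_def)
next
  case (Suc n)
  then obtain i y where x: "x = i # y" and i: "i \<in> {1..k}" and y: "y \<in> words n k"
    by (auto simp: words_Suc)
  show ?case
  proof (cases "i = j")
    case True
    then show ?thesis
      using relpow_sierpinski_Cons[OF Suc.IH[OF y i] i] x by simp
  next
    case False
    have "(replicate n j, replicate n i) \<in> sierpinski_arcs n k ^^ (2 ^ n - 1)"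
      using Suc.IH[OF replicate_words[OF i] \<open>j \<in> {1..k}\<close>] False by (simp add: corner_dist_replicate)
    from relpow_bridge[OF _ _ _ this Suc.IH[OF y]] show ?thesis
      using False Suc.prems(2) i x y by (simp add: words_def)
  qed
qed

text \<open>Inside a copy the leading letters contribute equally. At a bridge the two values are
  \<open>2 ^ n - 1\<close> and \<open>2 ^ n\<close> in some order if one of its copies is
  \<open>j\<close>, and equal otherwise.\<close>

lemma corner_dist_arc:
  "(x, y) \<in> sierpinski_arcs n k \<Longrightarrow> corner_dist j y \<le> corner_dist j x + 1"
proof (induction n arbitrary: x y)
  case (Suc n)
  then consider i x' y' where "x = i # x'" "y = i # y'" "(x', y') \<in> sierpinski_arcs n k"
    | i i' where "x = i # replicate n i'" "y = i' # replicate n i" "i \<noteq> i'"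
    by auto
  then show ?case
  proof cases
    case 1
    then have "length x' = length y'"
      using sierpinski_arcs_words by (fastforce simp: words_def)
    then show ?thesis
      using 1 Suc.IH by auto
  next
    case 2
    have "(1::nat) \<le> 2 ^ n"
      by simp
    then show ?thesis
      using 2 by (auto simp: corner_dist_replicate)
  qed
qed simp


section \<open>Sides and the central cycle\<close>

text \<open>The vertex at distance \<open>s\<close> from \<open>j\<^sup>n\<close> on the path of words over \<open>{j, k}\<close> from \<open>j\<^sup>n\<close> to \<open>k\<^sup>n\<close>.\<close>
primrec side :: "nat \<Rightarrow> nat \<Rightarrow> nat \<Rightarrow> nat \<Rightarrow> nat list" where
  "side 0 j k s = []"
| "side (Suc n) j k s = (if s < 2 ^ n then j # side n j k s else k # side n j k (s - 2 ^ n))"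

lemma length_side [simp]: "length (side n j k s) = n"
  by (induction n arbitrary: s) auto

lemma side_words: "j \<in> {1..K} \<Longrightarrow> k \<in> {1..K} \<Longrightarrow> side n j k s \<in> words n K"
  by (induction n arbitrary: s) (auto simp: words_def)

lemma side_first: "side n j k 0 = replicate n j"
  by (induction n) auto

lemma side_last: "side n j k (2 ^ n - Suc 0) = replicate n k"
proof (induction n)
  case (Suc n)
  have "(2::nat) * 2 ^ n - Suc 0 - 2 ^ n = 2 ^ n - Suc 0" "\<not> (2::nat) * 2 ^ n - Suc 0 < 2 ^ n"
    by simp_all
  with Suc show ?case
    by simp
qed simp

lemma corner_dist_side_first:
  "j \<noteq> k \<Longrightarrow> s < 2 ^ n \<Longrightarrow> corner_dist j (side n j k s) = s"
  by (induction n arbitrary: s) auto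

lemma corner_dist_side_last:
  "j \<noteq> k \<Longrightarrow> s < 2 ^ n \<Longrightarrow> corner_dist k (side n j k s) = 2 ^ n - 1 - s"
  by (induction n arbitrary: s) auto

lemma side_arc:
  assumes "j \<in> {1..K}" "k \<in> {1..K}" "j \<noteq> k"
  shows "Suc s < 2 ^ n \<Longrightarrow> (side n j k s, side n j k (Suc s)) \<in> sierpinski_arcs n K"
proof (induction n arbitrary: s)
  case (Suc n)
  consider "Suc s < 2 ^ n" | "Suc s = 2 ^ n" | "2 ^ n \<le> s"
    by linarith
  then show ?case
  proof cases
    case 1
    then show ?thesis
      using Suc.IH assms by simp
  next
    case 2
    then have "s = 2 ^ n - 1"
      by simp
    then show ?thesis
      using 2 assms bridge_arc[of j K k n] by (simp add: side_first side_last)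
  next
    case 3
    then have "Suc (s - 2 ^ n) < 2 ^ n"
      using Suc.prems by simp
    from Suc.IH[OF this] show ?thesis
      using 3 assms by (simp add: Suc_diff_le)
  qed
qed simp

text \<open>Cyclic order of the three copies: the central cycle enters copy \<open>i\<close> by the
  bridge from \<open>prev i\<close> and leaves it by the bridge to \<open>succ i\<close>.\<close>

definition prev :: "nat \<Rightarrow> nat" where
  "prev i = (if i = 1 then 3 else i - 1)"

definition succ :: "nat \<Rightarrow> nat" where
  "succ i = (if i = 3 then 1 else i + 1)"

text \<open>
  The vertices \<open>i w\<close> with \<open>w\<close> over \<open>[3] - {i}\<close> form the central cycle, of length \<open>3 * 2 ^ N\<close> in
  \<open>S(N + 1, 3)\<close>; \<open>angle\<close> is a non-expansive retraction of \<open>S(N + 1, 3)\<close> onto it.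
\<close>
definition cycle_vertex :: "nat \<Rightarrow> int \<Rightarrow> nat list" where
  "cycle_vertex N a = (let b = nat (a mod (3 * 2 ^ N)); i = Suc (b div 2 ^ N)
     in i # side N (prev i) (succ i) (b mod 2 ^ N))"

fun angle :: "nat list \<Rightarrow> int" where
  "angle [] = 0"
| "angle (i # x) = int ((i - 1) * 2 ^ length x + corner_dist (prev i) x)"

lemma prev_succ:
  assumes "i \<in> {1..3}"
  shows "prev i \<in> {1..3}" "succ i \<in> {1..3}" "prev i \<noteq> succ i" "succ i \<noteq> i" "prev (succ i) = i"
  using assms by (auto simp: prev_def succ_def)

lemma cycle_vertex_nat:
  assumes "b < 3 * 2 ^ N"
  obtains i s where "i \<in> {1..3}" "s < 2 ^ N" "b = (i - 1) * 2 ^ N + s"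
    "cycle_vertex N (int b) = i # side N (prev i) (succ i) s"
proof
  let ?i = "Suc (b div 2 ^ N)"
  have "b div 2 ^ N < 3"
    using assms by (simp add: less_mult_imp_div_less)
  then show "?i \<in> {1..3}"
    by simp
  show "b mod 2 ^ N < 2 ^ N"
    by simp
  show "b = (?i - 1) * 2 ^ N + b mod 2 ^ N"
    by (simp add: mult.commute)
  have "nat (int b mod (3 * 2 ^ N)) = b"
    using assms by (simp add: nat_mod_distrib nat_mult_distrib nat_power_eq)
  then show "cycle_vertex N (int b) = ?i # side N (prev ?i) (succ ?i) (b mod 2 ^ N)"
    by (simp add: cycle_vertex_def Let_def)
qed

lemma cycle_vertex_side:
  assumes "i \<in> {1..3}" "s < 2 ^ N"
  shows "cycle_vertex N (int ((i - 1) * 2 ^ N + s)) = i # side N (prev i) (succ i) s"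
proof -
  let ?b = "s + (i - 1) * 2 ^ N"
  have "(i - 1) * 2 ^ N \<le> 2 * 2 ^ N"
    using assms(1) by (intro mult_le_mono1) auto
  then have "?b < 3 * 2 ^ N"
    using assms(2) by linarith
  then have "nat (int ?b mod int (3 * 2 ^ N)) = ?b"
    by (simp only: zmod_int[symmetric] nat_int mod_less)
  moreover have "?b div 2 ^ N = i - 1" "?b mod 2 ^ N = s"
    using assms(2) by (simp_all only: div_mult_self1 mod_mult_self1 div_less mod_less)
  ultimately show ?thesis
    using assms(1) by (simp add: cycle_vertex_def Let_def add.commute)
qed

lemma cycle_vertex_cong:
  "a mod (3 * 2 ^ N) = b mod (3 * 2 ^ N) \<Longrightarrow> cycle_vertex N a = cycle_vertex N b"
  by (simp add: cycle_vertex_def)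

lemma cycle_vertex_reduce:
  obtains b where "b < 3 * 2 ^ N" "int b = a mod (3 * 2 ^ N)"
    "cycle_vertex N a = cycle_vertex N (int b)"
proof
  show "int (nat (a mod (3 * 2 ^ N))) = a mod (3 * 2 ^ N)"
    by simp
  show "nat (a mod (3 * 2 ^ N)) < 3 * 2 ^ N"
    by (simp add: nat_less_iff)
  show "cycle_vertex N a = cycle_vertex N (int (nat (a mod (3 * 2 ^ N))))"
    by (rule cycle_vertex_cong) simp
qed

lemma angle_cycle_vertex: "angle (cycle_vertex N a) = a mod (3 * 2 ^ N)"
proof -
  obtain b where b: "b < 3 * 2 ^ N" "int b = a mod (3 * 2 ^ N)"
    "cycle_vertex N a = cycle_vertex N (int b)"
    by (rule cycle_vertex_reduce)
  from b(1) obtain i s where "i \<in> {1..3}" "s < 2 ^ N" "b = (i - 1) * 2 ^ N + s"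
    "cycle_vertex N (int b) = i # side N (prev i) (succ i) s"
    by (rule cycle_vertex_nat)
  then show ?thesis
    using b(2,3) prev_succ by (simp add: corner_dist_side_first)
qed

lemma cycle_vertex_words: "cycle_vertex N a \<in> words (Suc N) 3"
proof -
  obtain b where b: "b < 3 * 2 ^ N" "cycle_vertex N a = cycle_vertex N (int b)"
    by (rule cycle_vertex_reduce)
  from b(1) obtain i s where "i \<in> {1..3}"
    "cycle_vertex N (int b) = i # side N (prev i) (succ i) s"
    by (rule cycle_vertex_nat)
  then show ?thesis
    using b(2) prev_succ side_words by (simp add: words_Suc)
qed

lemma cycle_vertex_arc:
  "(cycle_vertex N a, cycle_vertex N (a + 1)) \<in> sierpinski_arcs (Suc N) 3"
proof -
  obtain b where b: "b < 3 * 2 ^ N" "int b = a mod (3 * 2 ^ N)"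
    "cycle_vertex N a = cycle_vertex N (int b)"
    by (rule cycle_vertex_reduce)
  from b(1) obtain i s where i: "i \<in> {1..3}" and s: "s < 2 ^ N" and bis: "b = (i - 1) * 2 ^ N + s"
    and v: "cycle_vertex N (int b) = i # side N (prev i) (succ i) s"
    by (rule cycle_vertex_nat)
  have next_eq: "cycle_vertex N (a + 1) = cycle_vertex N (int (b + 1))"
    using b(2) mod_add_left_eq[of a "3 * 2 ^ N" 1]
    by (intro cycle_vertex_cong) (simp add: add.commute)
  note ps = prev_succ[OF i]
  show ?thesis
  proof (cases "Suc s < 2 ^ N")
    case True
    have "cycle_vertex N (int (b + 1)) = i # side N (prev i) (succ i) (Suc s)"
      using cycle_vertex_side[OF i True] bis by simp
    then show ?thesis
      using b(3) v next_eq side_arc[OF ps(1-3) True] i by simp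
  next
    case False
    with s have s_eq: "s = 2 ^ N - 1"
      by simp
    have "cycle_vertex N (int (b + 1)) = cycle_vertex N (int ((succ i - 1) * 2 ^ N))"
    proof (rule cycle_vertex_cong)
      have "b + 1 = i * 2 ^ N"
        using i bis s_eq by (simp add: mult_eq_if)
      \<comment> \<open>Leaving copy 3 completes a full turn, which is subtracted to arrive at the
        start of copy 1.\<close>
      then have "int (b + 1) = int ((succ i - 1) * 2 ^ N) + (if i = 3 then 3 * 2 ^ N else 0)"
        by (simp add: succ_def)
      then show "int (b + 1) mod (3 * 2 ^ N) = int ((succ i - 1) * 2 ^ N) mod (3 * 2 ^ N)"
        by simp
    qed
    also have "\<dots> = succ i # replicate N i"
      using cycle_vertex_side[OF ps(2), of 0 N] ps(5) by (simp add: side_first)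
    finally show ?thesis
      using b(3) v next_eq bridge_arc[OF i ps(2)] ps by (simp add: s_eq side_last)
  qed
qed

section \<open>Non-expansiveness of \<open>angle\<close>\<close>

lemma angle_extreme:
  assumes "i \<in> {1..3}"
  shows "angle (i # replicate N j) = (int i - 1) * 2 ^ N + (if j = prev i then 0 else 2 ^ N - 1)"
proof -
  have "int (2 ^ N - 1) = 2 ^ N - 1"
    by (simp add: of_nat_diff)
  then show ?thesis
    using assms by (simp add: corner_dist_replicate of_nat_diff)
qed

text \<open>Inside a copy this is \<open>corner_dist_arc\<close> in both directions; a bridge joins
  the end of one third of the circle to the start of the next. An explicit displacement
  \<open>e\<close> is kept because displacements add up along walks.\<close>

lemma angle_arc:
  assumes "(u, v) \<in> sierpinski_arcs (Suc N) 3"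
  shows "\<exists>e. \<bar>e\<bar> \<le> 1 \<and> (angle u + e) mod (3 * 2 ^ N) = angle v mod (3 * 2 ^ N)"
proof -
  from assms consider
      i x y where "u = i # x" "v = i # y" "(x, y) \<in> sierpinski_arcs N 3"
    | i j where "u = i # replicate N j" "v = j # replicate N i" "i \<in> {1..3}" "j \<in> {1..3}" "i \<noteq> j"
    by auto
  then show ?thesis
  proof cases
    case 1
    then have "length x = length y"
      using sierpinski_arcs_words by (fastforce simp: words_def)
    then have "\<bar>angle v - angle u\<bar> \<le> 1"
      using 1 corner_dist_arc[of x y N 3 "prev i"] corner_dist_arc[of y x N 3 "prev i"]
      by (auto dest: sierpinski_arcs_sym)
    then show ?thesis
      by (intro exI[of _ "angle v - angle u"]) simp
  next
    case 2
    note uv = this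
    then have ij: "i = 1 \<or> i = 2 \<or> i = 3" "j = 1 \<or> j = 2 \<or> j = 3"
      by auto
    with \<open>i \<noteq> j\<close> consider "j = succ i" | "i = succ j"
      by (auto simp: succ_def)
    then show ?thesis
    proof cases
      case 1
      then have "angle u + 1 = angle v + (if i = 3 then 3 * 2 ^ N else 0)"
        using 1 uv ij by (elim disjE) (simp_all add: angle_extreme prev_def succ_def del: angle.simps)
      then show ?thesis
        by (intro exI[of _ 1]) simp
    next
      case 2
      then have "angle u - 1 = angle v - (if j = 3 then 3 * 2 ^ N else 0)"
        using 2 uv ij by (elim disjE) (simp_all add: angle_extreme prev_def succ_def del: angle.simps)
      then show ?thesis
        by (intro exI[of _ "- 1"]) (simp add: minus_mod_self2)
    qed
  qed
qed

text \<open>Serves as the lower bound on distances: a walk is at least as long as the circular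
  distance between the angles of its ends.\<close>

lemma angle_relpow:
  "(u, v) \<in> sierpinski_arcs (Suc N) 3 ^^ d \<Longrightarrow>
    \<exists>e. \<bar>e\<bar> \<le> int d \<and> (angle u + e) mod (3 * 2 ^ N) = angle v mod (3 * 2 ^ N)"
proof (induction d arbitrary: v)
  case 0
  then show ?case
    by (intro exI[of _ 0]) simp
next
  case (Suc d)
  then obtain w where "(u, w) \<in> sierpinski_arcs (Suc N) 3 ^^ d" "(w, v) \<in> sierpinski_arcs (Suc N) 3"
    by (meson relpow_Suc_E)
  then obtain e e' where e: "\<bar>e\<bar> \<le> int d" "(angle u + e) mod (3 * 2 ^ N) = angle w mod (3 * 2 ^ N)"
    and e': "\<bar>e'\<bar> \<le> 1" "(angle w + e') mod (3 * 2 ^ N) = angle v mod (3 * 2 ^ N)"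
    using Suc.IH angle_arc by blast
  have "(angle u + (e + e')) mod (3 * 2 ^ N) = angle v mod (3 * 2 ^ N)"
    using e(2) e'(2) by (metis add.assoc mod_add_left_eq)
  then show ?case
    using e(1) e'(1) by (intro exI[of _ "e + e'"]) auto
qed


section \<open>The robber's strategy\<close>

declare sierpinski_arcs.simps(2) [simp del]

text \<open>The robber answers the cop's latest position by its image under \<open>T\<close>. The
  cop's position depends on earlier robber moves only, so recursion on rounds is possible; staying
  put as fallback keeps the play legal against any \<open>\<sigma>\<close>.\<close>

lemma ex_shadow_play:
  "\<exists>\<rho>. \<rho> 0 = T (cop_pos \<sigma> \<rho> 0) \<and>
    (\<forall>t. \<rho> (Suc t) = (if legal_move G (\<rho> t) (T (cop_pos \<sigma> \<rho> (Suc t)))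
                      then T (cop_pos \<sigma> \<rho> (Suc t)) else \<rho> t))"
proof -
  define ext where "ext = (\<lambda>(H, p). H @ [(\<sigma> H, p)])"
  \<comment> \<open>The state pairs the history of the earlier rounds with the robber's current
    position.\<close>
  define f where "f = rec_nat ([], T (\<sigma> []))
    (\<lambda>_ st. (ext st, if legal_move G (snd st) (T (\<sigma> (ext st))) then T (\<sigma> (ext st)) else snd st))"
  define \<rho> where "\<rho> t = snd (f t)" for t
  have hist: "history \<sigma> \<rho> t = fst (f t)" for t
    by (induction t) (simp_all add: f_def \<rho>_def ext_def case_prod_unfold)
  show ?thesis
    by (rule exI[of _ \<rho>]) (simp add: cop_pos_def hist del: history.simps, simp add: \<rho>_def f_def)
qed

lemma winning_radius_ge:
  assumes "winning_strategy (with_proj (sierpinski (m + 2) 3)) r \<sigma>"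
  shows "3 * 2 ^ m - 1 \<le> r"
proof (rule ccontr)
  let ?G = "with_proj (sierpinski (m + 2) 3)"
  let ?A = "sierpinski_arcs (m + 2) 3"
  let ?L = "3 * 2 ^ Suc m :: int"
  assume "\<not> 3 * 2 ^ m - 1 \<le> r"
  then have "r + 1 < 3 * 2 ^ m"
    by simp
  then have "int (r + 1) < int (3 * 2 ^ m)"
    by (rule of_nat_less_iff[THEN iffD2])
  then have r: "int r + 1 < 3 * 2 ^ m"
    by simp
  \<comment> \<open>The shift is half of the period \<open>?L\<close>, so \<open>T u\<close> is the
    antipode of the image of \<open>u\<close> on the cycle.\<close>
  define T where "T u = cycle_vertex (Suc m) (angle u + 3 * 2 ^ m)" for u
  obtain \<rho> where \<rho>0: "\<rho> 0 = T (cop_pos \<sigma> \<rho> 0)"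
    and \<rho>Suc: "\<And>t. \<rho> (Suc t) = (if legal_move ?G (\<rho> t) (T (cop_pos \<sigma> \<rho> (Suc t)))
                      then T (cop_pos \<sigma> \<rho> (Suc t)) else \<rho> t)"
    using ex_shadow_play[of T \<sigma> ?G] by blast
  define c where "c = cop_pos \<sigma> \<rho>"
  have "legal_play ?G \<rho>"
    unfolding legal_play_def
  proof (intro conjI allI)
    show "\<rho> 0 \<in> verts ?G"
      using \<rho>0 cycle_vertex_words[of "Suc m"] by (simp add: T_def)
    show "legal_move ?G (\<rho> t) (\<rho> (Suc t))" for t
      using \<rho>Suc[of t] by (auto simp: legal_move_def)
  qed
  \<comment> \<open>The strategy promises legal cop moves only against a legal robber, so legality
    of \<open>\<rho>\<close> had to come first, from the fallback.\<close>
  then have c_legal: "legal_play ?G c" and capt: "captures ?G r c \<rho>"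
    using assms by (auto simp: winning_strategy_def c_def)
  have c_words: "c t \<in> words (m + 2) 3" for t
  proof (induction t)
    case (Suc t)
    have "legal_move ?G (c t) (c (Suc t))"
      using c_legal by (simp add: legal_play_def)
    then show ?case
      using Suc by (auto simp: legal_move_def dest: sierpinski_arcs_words)
  qed (use c_legal in \<open>simp add: legal_play_def\<close>)
  have c_step: "\<exists>e. \<bar>e\<bar> \<le> 1 \<and> (angle (c t) + e) mod ?L = angle (c (Suc t)) mod ?L" for t
  proof -
    have "legal_move ?G (c t) (c (Suc t))"
      using c_legal by (simp add: legal_play_def)
    then consider "c t = c (Suc t)" | "(c t, c (Suc t)) \<in> sierpinski_arcs (Suc (Suc m)) 3"
      by (auto simp: legal_move_def)
    then show ?thesis
    proof cases
      case 1
      then show ?thesis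
        by (intro exI[of _ 0]) simp
    next
      case 2
      then show ?thesis
        by (rule angle_arc)
    qed
  qed
  have T_step: "legal_move ?G (T (c t)) (T (c (Suc t)))" for t
  proof -
    obtain e where e: "\<bar>e\<bar> \<le> 1" "(angle (c t) + e) mod ?L = angle (c (Suc t)) mod ?L"
      using c_step by blast
    let ?a = "angle (c t) + 3 * 2 ^ m"
    have "(?a + e) mod ?L = (angle (c (Suc t)) + 3 * 2 ^ m) mod ?L"
      using mod_add_cong[OF e(2) refl[of "3 * 2 ^ m mod ?L"]] by (simp add: algebra_simps)
    then have T_Suc: "T (c (Suc t)) = cycle_vertex (Suc m) (?a + e)"
      unfolding T_def by (intro cycle_vertex_cong) simp
    have "e = 0 \<or> e = 1 \<or> e = - 1"
      using e(1) by auto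
    then show ?thesis
      using cycle_vertex_arc[of "Suc m" ?a]
        sierpinski_arcs_sym[OF cycle_vertex_arc[of "Suc m" "?a - 1"]]
      by (auto simp: legal_move_def T_Suc) (simp_all add: T_def)
  qed
  \<comment> \<open>Antipodes move along with the cop, so the fallback never occurs.\<close>
  have \<rho>: "\<rho> t = T (c t)" for t
    by (induction t) (use \<rho>0 \<rho>Suc T_step in \<open>simp_all add: c_def\<close>)
  \<comment> \<open>The bound is \<open>r + 1\<close> instead of \<open>r\<close> to cover the test
    after the cop's move, when the robber is still opposite to the cop's previous position.\<close>
  have far: False if "\<bar>e\<bar> \<le> int r + 1" "(angle (c t) + e) mod ?L = (angle (c t) + 3 * 2 ^ m) mod ?L" for e t
  proof -
    have "?L dvd (angle (c t) + 3 * 2 ^ m) - (angle (c t) + e)"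
      using that(2) by (metis mod_eq_dvd_iff)
    then have "?L dvd 3 * 2 ^ m - e"
      by simp
    moreover have "0 < 3 * 2 ^ m - e" "3 * 2 ^ m - e < ?L"
      using that(1) r by auto
    ultimately show False
      using zdvd_not_zless by blast
  qed
  have angle_\<rho>: "angle (\<rho> t) mod ?L = (angle (c t) + 3 * 2 ^ m) mod ?L" for t
    by (simp add: \<rho> T_def angle_cycle_vertex)
  from capt obtain t where "graph_dist ?G (c t) (\<rho> t) \<le> ereal (real r) \<or>
      graph_dist ?G (c (Suc t)) (\<rho> t) \<le> ereal (real r)"
    by (auto simp: captures_def)
  then show False
  proof
    assume "graph_dist ?G (c t) (\<rho> t) \<le> ereal (real r)"
    then obtain d where d: "d \<le> r" "(c t, \<rho> t) \<in> sierpinski_arcs (Suc (Suc m)) 3 ^^ d"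
      using graph_dist_sierpinski_le_iff[OF c_words] by auto
    obtain e where "\<bar>e\<bar> \<le> int d" "(angle (c t) + e) mod ?L = angle (\<rho> t) mod ?L"
      using angle_relpow[OF d(2)] by blast
    then show False
      using far[of e t] angle_\<rho>[of t] d(1) by simp
  next
    assume "graph_dist ?G (c (Suc t)) (\<rho> t) \<le> ereal (real r)"
    then obtain d where d: "d \<le> r" "(c (Suc t), \<rho> t) \<in> sierpinski_arcs (Suc (Suc m)) 3 ^^ d"
      using graph_dist_sierpinski_le_iff[OF c_words] by auto
    obtain e where e: "\<bar>e\<bar> \<le> int d" "(angle (c (Suc t)) + e) mod ?L = angle (\<rho> t) mod ?L"
      using angle_relpow[OF d(2)] by blast
    obtain e' where e': "\<bar>e'\<bar> \<le> 1" "(angle (c t) + e') mod ?L = angle (c (Suc t)) mod ?L"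
      using c_step by blast
    have "(angle (c t) + (e' + e)) mod ?L = angle (\<rho> t) mod ?L"
      using e(2) e'(2) by (metis add.assoc mod_add_left_eq)
    moreover have "\<bar>e' + e\<bar> \<le> int r + 1"
      using e(1) e'(1) d(1) by linarith
    ultimately show False
      using far angle_\<rho> by metis
  qed
qed


section \<open>The cop's strategy\<close>

text \<open>The \<open>min\<close> parks the cop at the end of the side, so that the sequence is
  legal for all times.\<close>

definition patrol :: "nat \<Rightarrow> nat \<Rightarrow> nat list" where
  "patrol N t = 1 # side N 2 3 (min t (2 ^ N - 1))"

lemma patrol_words: "patrol N t \<in> words (Suc N) 3"
  using side_words[of 2 3 3 N] by (simp add: patrol_def words_Suc)

lemma patrol_step: "patrol N t = patrol N (Suc t) \<or>
  (patrol N t, patrol N (Suc t)) \<in> sierpinski_arcs (Suc N) 3"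
proof (cases "Suc t < 2 ^ N")
  case True
  then have "min t (2 ^ N - 1) = t" "min (Suc t) (2 ^ N - 1) = Suc t"
    by auto
  then show ?thesis
    using relpow_sierpinski_Cons[where d = 1 and i = 1] side_arc[of 2 3 3 t N] True
    by (simp add: patrol_def)
next
  case False
  then have "min t (2 ^ N - 1) = min (Suc t) (2 ^ N - 1)"
    by auto
  then show ?thesis
    by (simp add: patrol_def)
qed

text \<open>The two ways round the central cycle: directly over the bridge from copy 1 to copy 3, or
  through copy 2, which is crossed in \<open>2 ^ N - 1\<close> steps.\<close>

lemma patrol_walks:
  assumes x: "x \<in> words N 3" and s: "s < 2 ^ N"
  shows "(patrol N s, 3 # x) \<in> sierpinski_arcs (Suc N) 3 ^^ (2 ^ N - s + corner_dist 1 x)"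
    and "(patrol N s, 3 # x) \<in> sierpinski_arcs (Suc N) 3 ^^ (2 ^ N + s + 1 + corner_dist 2 x)"
proof -
  let ?v = "side N 2 3 s"
  have p: "patrol N s = 1 # ?v"
  proof -
    have "min s (2 ^ N - 1) = s"
      using s by auto
    then show ?thesis
      by (simp only: patrol_def)
  qed
  have v: "?v \<in> words N 3"
    by (simp add: side_words)
  have "(?v, replicate N 3) \<in> sierpinski_arcs N 3 ^^ (2 ^ N - 1 - s)"
    using relpow_sierpinski_sym[OF corner_walk[OF v, of 3]] s by (simp add: corner_dist_side_last)
  from relpow_bridge[OF _ _ _ this corner_walk[OF x]]
  have "(1 # ?v, 3 # x) \<in> sierpinski_arcs (Suc N) 3 ^^ (2 ^ N - 1 - s + 1 + corner_dist 1 x)"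
    by simp
  moreover have "2 ^ N - 1 - s + 1 = 2 ^ N - s"
    using s by simp
  ultimately show "(patrol N s, 3 # x) \<in> sierpinski_arcs (Suc N) 3 ^^ (2 ^ N - s + corner_dist 1 x)"
    by (simp only: p)
  have to2: "(?v, replicate N 2) \<in> sierpinski_arcs N 3 ^^ s"
    using relpow_sierpinski_sym[OF corner_walk[OF v, of 2]] s by (simp add: corner_dist_side_first)
  have across: "(replicate N 1, replicate N 3) \<in> sierpinski_arcs N 3 ^^ (2 ^ N - 1)"
    using corner_walk[OF replicate_words, of 3 3 1 N] by (simp add: corner_dist_replicate)
  have "(1 # ?v, 2 # replicate N 1) \<in> sierpinski_arcs (Suc N) 3 ^^ (s + 1 + 0)"
    by (rule relpow_bridge[OF _ _ _ to2]) auto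
  moreover have "(2 # replicate N 1, 3 # x) \<in>
      sierpinski_arcs (Suc N) 3 ^^ (2 ^ N - 1 + 1 + corner_dist 2 x)"
    by (rule relpow_bridge[OF _ _ _ across corner_walk[OF x]]) auto
  ultimately have "(1 # ?v, 3 # x) \<in>
      sierpinski_arcs (Suc N) 3 ^^ (s + 1 + 0 + (2 ^ N - 1 + 1 + corner_dist 2 x))"
    by (rule relpow_trans)
  moreover have "s + 1 + 0 + (2 ^ N - 1 + 1 + corner_dist 2 x) = 2 ^ N + s + 1 + corner_dist 2 x"
    by simp
  ultimately show "(patrol N s, 3 # x) \<in>
      sierpinski_arcs (Suc N) 3 ^^ (2 ^ N + s + 1 + corner_dist 2 x)"
    by (simp only: p)
qed

text \<open>The cop starts at the end of the bridge between copies 1 and 2, so both copies are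
  close.\<close>

lemma patrol_start:
  assumes "y \<in> words (Suc N) 3" "hd y \<noteq> 3"
  shows "\<exists>d\<le>2 ^ N. (patrol N 0, y) \<in> sierpinski_arcs (Suc N) 3 ^^ d"
proof -
  from assms(1) obtain i x where y: "y = i # x" "i \<in> {1..3}" and x: "x \<in> words N 3"
    by (auto simp: words_Suc)
  have p: "patrol N 0 = 1 # replicate N 2"
    by (simp add: patrol_def side_first)
  have len: "length x = N"
    using x by (simp add: words_def)
  from y assms(2) consider "i = 1" | "i = 2"
    by fastforce
  then show ?thesis
  proof cases
    case 1
    then show ?thesis
      using relpow_sierpinski_Cons[OF corner_walk[OF x], of 2 1] corner_dist_less[of 2 x] p y len
      by (intro exI[of _ "corner_dist 2 x"]) auto
  next
    case 2
    have "(replicate N 2, replicate N 2) \<in> sierpinski_arcs N 3 ^^ 0"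
      by simp
    from relpow_bridge[OF _ _ _ this corner_walk[OF x], of 1] show ?thesis
      using 2 corner_dist_less[of 1 x] p y len
      by (intro exI[of _ "0 + 1 + corner_dist 1 x"]) auto
  qed
qed

text \<open>
  For a robber at \<open>3 x\<close> let \<open>L\<close> and \<open>R\<close> be the lengths of the two walks of \<open>patrol_walks\<close>; the robber
  is safe only if both are at least \<open>3 * 2 ^ m\<close>. A step of the cop decreases \<open>L\<close> and increases \<open>R\<close>, so
  a robber who is safe before and after it has \<open>L + R > 6 * 2 ^ m\<close> afterwards. At the two exits of
  the third copy \<open>L + R = 6 * 2 ^ m\<close>, hence the robber never leaves it.
\<close>
lemma patrol_captures:
  assumes legal: "legal_play (with_proj (sierpinski (m + 2) 3)) \<rho>"
  shows "captures (with_proj (sierpinski (m + 2) 3)) (3 * 2 ^ m - 1) (patrol (Suc m)) \<rho>"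
proof (rule ccontr)
  let ?G = "with_proj (sierpinski (m + 2) 3)"
  let ?M = "2 ^ Suc m :: nat"
  let ?c = "patrol (Suc m)"
  assume nocap: "\<not> captures ?G (3 * 2 ^ m - 1) ?c \<rho>"
  have far: "3 * 2 ^ m \<le> d"
    if "(?c s, \<rho> t) \<in> sierpinski_arcs (Suc (Suc m)) 3 ^^ d" "s = t \<or> s = Suc t" for s t d
  proof (rule ccontr)
    assume "\<not> 3 * 2 ^ m \<le> d"
    then have "d \<le> 3 * 2 ^ m - 1"
      by simp
    then have "graph_dist ?G (?c s) (\<rho> t) \<le> ereal (real (3 * 2 ^ m - 1))"
      using that(1) graph_dist_sierpinski_le_iff[OF patrol_words[of "Suc m" s]]
      unfolding add_2_eq_Suc' by blast
    then show False
      using nocap that(2) unfolding captures_def by blast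
  qed
  have move: "\<rho> t = \<rho> (Suc t) \<or> (\<rho> t, \<rho> (Suc t)) \<in> sierpinski_arcs (Suc (Suc m)) 3" for t
    using legal by (auto simp: legal_play_def legal_move_def)
  have \<rho>0: "\<rho> 0 \<in> words (Suc (Suc m)) 3"
    using legal by (simp add: legal_play_def)
  have third: "t < ?M \<Longrightarrow> \<exists>x \<in> words (Suc m) 3. \<rho> t = 3 # x" for t
  proof (induction t)
    case 0
    have "hd (\<rho> 0) = 3"
    proof (rule ccontr)
      assume "hd (\<rho> 0) \<noteq> 3"
      from patrol_start[OF \<rho>0 this] far[of 0 0] have "3 * 2 ^ m \<le> ?M"
        by (meson order_trans)
      then show False
        by simp
    qed
    then show ?case
      using \<rho>0 by (auto simp: words_Suc)
  next
    case (Suc t)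
    then obtain x where x: "x \<in> words (Suc m) 3" "\<rho> t = 3 # x"
      by auto
    \<comment> \<open>\<open>L\<close> is taken after the cop's move and \<open>R\<close> before it,
      with the robber at the same vertex; in the sum \<open>t\<close> cancels.\<close>
    have "3 * 2 ^ m \<le> ?M - Suc t + corner_dist 1 x"
      using patrol_walks(1)[OF x(1), of "Suc t"] far[of "Suc t" t] Suc.prems x(2) by auto
    moreover have "3 * 2 ^ m \<le> ?M + t + 1 + corner_dist 2 x"
      using patrol_walks(2)[OF x(1), of t] far[of t t] Suc.prems x(2) by auto
    ultimately have ge: "?M \<le> corner_dist 1 x + corner_dist 2 x"
      using Suc.prems by simp
    \<comment> \<open>At the exits towards copies 1 and 2 the sum of the corner distances is
      \<open>?M - 1\<close>, just one too small.\<close>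
    have "x \<noteq> replicate (Suc m) j" if "j = 1 \<or> j = 2" for j
    proof
      assume "x = replicate (Suc m) j"
      then have "corner_dist i x = (if j = i then 0 else ?M - 1)" for i
        by (simp only: corner_dist_replicate)
      from this[of 1] this[of 2] that have "corner_dist 1 x + corner_dist 2 x = ?M - 1"
        by auto
      moreover have "0 < ?M"
        by simp
      ultimately show False
        using ge by linarith
    qed
    then have no_exit: "x \<noteq> replicate (Suc m) 1" "x \<noteq> replicate (Suc m) 2"
      by blast+
    from move[of t] show ?case
    proof
      assume "\<rho> t = \<rho> (Suc t)"
      then show ?thesis
        using x by metis
    next
      assume arc: "(\<rho> t, \<rho> (Suc t)) \<in> sierpinski_arcs (Suc (Suc m)) 3"
      then have "\<rho> (Suc t) \<in> words (Suc (Suc m)) 3"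
        using sierpinski_arcs_words by blast
      moreover have "hd (\<rho> (Suc t)) = 3"
      proof (rule ccontr)
        assume "hd (\<rho> (Suc t)) \<noteq> 3"
        then obtain j where "j \<in> {1..3}" "j \<noteq> 3" "x = replicate (Suc m) j"
          using arc x(2) by (subst (asm) sierpinski_arcs.simps(2)) force
        moreover have "j = 1 \<or> j = 2" if "j \<in> {1..3}" "j \<noteq> 3"
          using that by (simp, linarith)
        ultimately show False
          using no_exit by blast
      qed
      ultimately show ?thesis
        by (auto simp: words_Suc[of "Suc m"])
    qed
  qed
  have "?M - 1 < ?M"
    by simp
  then obtain x where x: "x \<in> words (Suc m) 3" "\<rho> (?M - 1) = 3 # x"
    using third by blast
  \<comment> \<open>The cop now stands at the bridge to copy 3, so the direct walk has length
    \<open>1 + corner_dist 1 x\<close>, at most \<open>2 * 2 ^ m\<close>.\<close>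
  have "3 * 2 ^ m \<le> ?M - (?M - 1) + corner_dist 1 x"
    using patrol_walks(1)[OF x(1), of "?M - 1"] far[of "?M - 1" "?M - 1"] x(2) by auto
  moreover have "corner_dist 1 x < ?M"
    using corner_dist_less[of 1 x] x(1) by (simp add: words_def)
  moreover have "0 < (2::nat) ^ m"
    by simp
  ultimately show False
    by simp
qed

lemma length_history [simp]: "length (history \<sigma> \<rho> t) = t"
  by (induction t) auto

lemma sierpinski_in_CWRC: "with_proj (sierpinski (m + 2) 3) \<in> CWRC (3 * 2 ^ m - 1)"
proof -
  let ?G = "with_proj (sierpinski (m + 2) 3)"
  \<comment> \<open>The length of the history is the round number, which serves as the clock of the
    patrol.\<close>
  let ?\<sigma> = "\<lambda>H. patrol (Suc m) (length H)"
  have pos: "cop_pos ?\<sigma> \<rho> = patrol (Suc m)" for \<rho>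
    by (simp add: fun_eq_iff cop_pos_def)
  have "legal_play ?G (patrol (Suc m))"
    using patrol_words[of "Suc m"] patrol_step[of "Suc m"]
    by (auto simp: legal_play_def legal_move_def)
  then have "winning_strategy ?G (3 * 2 ^ m - 1) ?\<sigma>"
    using patrol_captures by (simp add: winning_strategy_def pos)
  moreover have "verts ?G \<noteq> {}"
    using patrol_words[of "Suc m"] by auto
  ultimately show ?thesis
    using graph_sierpinski by (auto simp: CWRC_def)
qed

theorem theorem5p3:
  fixes n :: nat
  assumes "n \<ge> 3"
  shows "rc (with_proj (sierpinski n 3)) = 3 * 2 ^ (n - 2) - 1"
proof -
  define m where "m = n - 2"
  then have n: "n = m + 2"
    using assms by simp
  have "3 * 2 ^ m - 1 \<le> r" if "with_proj (sierpinski (m + 2) 3) \<in> CWRC r" for r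
    using that winning_radius_ge unfolding CWRC_def by blast
  with sierpinski_in_CWRC show ?thesis
    unfolding rc_def n add_diff_cancel_right' by (intro Least_equality)
qed

end
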